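(* In a generic compact metric space, three distinct points are never collinear: the set of $X\in\mathfrak{M}$ in which no three pairwise distinct points are collinear is a residual subset of the Gromov-Hausdorff space $(\mathfrak{M},d_{GH})$.
   Context: $\mathfrak{M}$ denotes the Gromov-Hausdorff space: the set of all nonempty compact metric spaces up to isometry, endowed with the Gromov-Hausdorff distance $d_{GH}(X,Y)=\inf d_H^Z(f(X),g(Y))$, where the infimum is over all metric spaces $Z$ and all isometric injections $f:X\to Z$, $g:Y\to Z$, and $d_H^Z$ is the Hausdorff distance between subsets of $Z$. The metric space $\mathfrak{M}$ is complete, hence a Baire space. A subset is rare if its closure has empty interior, meager if it is a countable union of rare sets, and residual if its complement is meager. "A generic compact metric space has property $P$" means that the set of $X\in\mathfrak{M}$ having $P$ is residual in $\mathfrak{M}$. Three points $x,y,z$ of a metric space are collinear if one of the three distances $d(x,y),d(y,z),d(x,z)$ equals the sum of the two others. *)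

theory Defs
  imports "HOL-Analysis.Analysis"
begin

section \<open>Hausdorff and Gromov--Hausdorff distance\<close>

definition hausdorff_dist :: "'a metric \<Rightarrow> 'a set \<Rightarrow> 'a set \<Rightarrow> real" where
  "hausdorff_dist Z A B =
     Inf {r. 0 \<le> r \<and> (\<forall>a\<in>A. \<exists>b\<in>B. mdist Z a b \<le> r) \<and> (\<forall>b\<in>B. \<exists>a\<in>A. mdist Z a b \<le> r)}"

definition isometric_injection :: "'a metric \<Rightarrow> 'b metric \<Rightarrow> ('a \<Rightarrow> 'b) \<Rightarrow> bool" where
  "isometric_injection X Z f \<longleftrightarrow>
     f \<in> mspace X \<rightarrow> mspace Z \<and> (\<forall>x\<in>mspace X. \<forall>y\<in>mspace X. mdist Z (f x) (f y) = mdist X x y)"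

definition isometric :: "'a metric \<Rightarrow> 'b metric \<Rightarrow> bool" where
  "isometric X Y \<longleftrightarrow> (\<exists>f. isometric_injection X Y f \<and> f ` mspace X = mspace Y)"

definition compact_metric :: "'a metric \<Rightarrow> bool" where
  "compact_metric X \<longleftrightarrow> mspace X \<noteq> {} \<and> compact_space (mtopology_of X)"

text \<open>
  A compact metric space has at most the cardinality of the continuum, so every isometry class is
  represented by a metric on a subset of \<^typ>\<open>real\<close>. Only the cardinality of this type matters; its
  usual metric plays no role. Likewise, replacing an ambient space \<open>Z\<close> by the union of the two
  images does not change the Hausdorff distance between them, so the infimum over all ambient spaces
  may be taken over ambient spaces carried by subsets of \<^typ>\<open>real\<close>. See the lemmas
  \<open>compact_metric_isometric_real\<close> and \<open>gh_dist_le_hausdorff_dist\<close> below.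
\<close>

definition gh_dist :: "real metric \<Rightarrow> real metric \<Rightarrow> real" where
  "gh_dist X Y =
     Inf {hausdorff_dist Z (f ` mspace X) (g ` mspace Y) | (Z :: real metric) f g.
            isometric_injection X Z f \<and> isometric_injection Y Z g}"

lemma isometric_injection_inj_on:
  assumes "isometric_injection X Z f"
  shows "inj_on f (mspace X)"
  using assms unfolding isometric_injection_def inj_on_def by (metis mdist_zero)

lemma isometric_refl: "isometric X X"
  unfolding isometric_def isometric_injection_def by (rule exI[of _ id]) auto

lemma isometric_sym:
  assumes "isometric X Y"
  shows "isometric Y X"
proof -
  obtain f where f: "isometric_injection X Y f" "f ` mspace X = mspace Y"
    using assms unfolding isometric_def by blast
  have inj: "inj_on f (mspace X)"
    using f(1) by (rule isometric_injection_inj_on)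
  let ?g = "inv_into (mspace X) f"
  have g: "?g y \<in> mspace X" "f (?g y) = y" if "y \<in> mspace Y" for y
    using that f(2) by (auto intro: inv_into_into f_inv_into_f)
  have "?g ` mspace Y = mspace X"
    using inj f(2) by (metis inv_into_image_cancel order_refl)
  moreover have "isometric_injection Y X ?g"
    using f(1) g unfolding isometric_injection_def by (metis Pi_I)
  ultimately show ?thesis unfolding isometric_def by blast
qed

lemma isometric_injection_comp:
  assumes "isometric_injection X Y f" "isometric_injection Y Z g"
  shows "isometric_injection X Z (g \<circ> f)"
  using assms unfolding isometric_injection_def by (auto simp: Pi_iff)

lemma isometric_trans:
  assumes "isometric X Y" "isometric Y Z"
  shows "isometric X Z"
  using assms unfolding isometric_def by (metis isometric_injection_comp image_comp)

lemma gh_dist_isometric_le: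
  assumes "isometric X X'" "isometric Y Y'"
  shows "{hausdorff_dist Z (f ` mspace X') (g ` mspace Y') | (Z :: real metric) f g.
            isometric_injection X' Z f \<and> isometric_injection Y' Z g}
       \<subseteq> {hausdorff_dist Z (f ` mspace X) (g ` mspace Y) | (Z :: real metric) f g.
            isometric_injection X Z f \<and> isometric_injection Y Z g}"
proof -
  obtain h k where h: "isometric_injection X X' h" "h ` mspace X = mspace X'"
    and k: "isometric_injection Y Y' k" "k ` mspace Y = mspace Y'"
    using assms unfolding isometric_def by blast
  have "hausdorff_dist Z (f ` mspace X') (g ` mspace Y')
      = hausdorff_dist Z ((f \<circ> h) ` mspace X) ((g \<circ> k) ` mspace Y)" for Z :: "real metric" and f g
    by (simp only: h(2)[symmetric] k(2)[symmetric] image_comp)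
  with isometric_injection_comp[OF h(1)] isometric_injection_comp[OF k(1)] show ?thesis
    by (smt (verit, best) mem_Collect_eq subsetI)
qed

lemma gh_dist_isometric:
  assumes "isometric X X'" "isometric Y Y'"
  shows "gh_dist X Y = gh_dist X' Y'"
  unfolding gh_dist_def
  by (intro arg_cong[where f = Inf] subset_antisym gh_dist_isometric_le assms assms[THEN isometric_sym])

lemma isometric_pushforward:
  fixes h :: "'a \<Rightarrow> 'b" and X :: "'a metric"
  assumes h: "inj_on h (mspace X)"
  obtains Y :: "'b metric" where "isometric_injection X Y h" "h ` mspace X = mspace Y"
proof -
  let ?k = "inv_into (mspace X) h"
  have k: "?k (h x) = x" if "x \<in> mspace X" for x
    using h that by simp
  interpret Metric_space "h ` mspace X" "\<lambda>u v. mdist X (?k u) (?k v)"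
  proof
    show "mdist X (?k u) (?k v) = mdist X (?k v) (?k u)" for u v
      by (rule mdist_commute)
    show "mdist X (?k u) (?k w) \<le> mdist X (?k u) (?k v) + mdist X (?k v) (?k w)"
      if "u \<in> h ` mspace X" "v \<in> h ` mspace X" "w \<in> h ` mspace X" for u v w
      using that by (intro mdist_triangle inv_into_into)
  qed (auto simp: k)
  show ?thesis
    by (rule that[of Self]) (simp_all add: isometric_injection_def k)
qed

lemma compact_metric_isometric:
  assumes X: "compact_metric X" and "isometric X Y"
  shows "compact_metric Y"
proof -
  interpret Metric_space12 "mspace X" "mdist X" "mspace Y" "mdist Y"
    by (simp add: Metric_space12_mspace_mdist)
  obtain f where f: "isometric_injection X Y f" "f ` mspace X = mspace Y"
    using assms(2) unfolding isometric_def by blast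
  have "homeomorphic_map (mtopology_of X) (mtopology_of Y) f"
    unfolding mtopology_of_def
  proof (rule isometry_imp_homeomorphic_map)
    show "mdist Y (f x) (f y) = mdist X x y" if "x \<in> mspace X" "y \<in> mspace X" for x y
      using f(1) that by (simp add: isometric_injection_def)
  qed (fact f(2))
  then have "compact_space (mtopology_of Y)"
    using X homeomorphic_compact_space homeomorphic_map_imp_homeomorphic_space
    unfolding compact_metric_def by blast
  moreover have "mspace Y \<noteq> {}"
    using X unfolding f(2)[symmetric] by (simp add: compact_metric_def)
  ultimately show ?thesis
    by (simp add: compact_metric_def)
qed

lemma compact_metric_isometric_real:
  fixes X :: "'a metric"
  assumes X: "compact_metric X"
  obtains Y :: "real metric" where "compact_metric Y" "isometric X Y"
proof -
  interpret Metric_space "mspace X" "mdist X" by simp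
  have "mtotally_bounded (mspace X)"
    using X by (simp add: compact_metric_def mtopology_of_def compact_space_eq_mcomplete_mtotally_bounded)
  then have "\<exists>K. finite K \<and> K \<subseteq> mspace X \<and> mspace X \<subseteq> (\<Union>x\<in>K. mball x (1 / Suc n))" for n
    unfolding mtotally_bounded_def by simp
  then obtain K where K: "\<And>n. finite (K n)" "\<And>n. K n \<subseteq> mspace X"
      "\<And>n. mspace X \<subseteq> (\<Union>x\<in>K n. mball x (1 / Suc n))"
    by metis
  define C where "C = (\<Union>n. K n)"
  have C: "countable C"
    unfolding C_def using K(1) by (simp add: countable_finite)
  define h where "h x = {prod_encode (n, to_nat_on C q) | n q. q \<in> C \<and> mdist X q x < 1 / Suc n}" for x
  have "inj_on h (mspace X)"
  proof (rule inj_onI, rule ccontr)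
    fix x y assume xy: "x \<in> mspace X" "y \<in> mspace X" "h x = h y" "x \<noteq> y"
    then have "mdist X x y / 2 > 0" by simp
    then obtain n where n: "1 / Suc n < mdist X x y / 2"
      using nat_approx_posE by blast
    obtain q where q: "q \<in> K n" "mdist X q x < 1 / Suc n"
      using K(3)[of n] xy(1) by auto
    then have qC: "q \<in> C" unfolding C_def by blast
    then have "prod_encode (n, to_nat_on C q) \<in> h y"
      using q(2) xy(3)[symmetric] unfolding h_def by blast
    then obtain q' where "q' \<in> C" "to_nat_on C q = to_nat_on C q'" "mdist X q' y < 1 / Suc n"
      unfolding h_def by auto
    then have "mdist X q y < 1 / Suc n"
      using qC to_nat_on_inj[OF C] by simp
    moreover have "mdist X x y \<le> mdist X q x + mdist X q y"
      using mdist_triangle[of x X q y] mdist_commute[of X x q] xy q(1) K(2) by auto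
    ultimately show False using q(2) n by linarith
  qed
  moreover obtain b :: "nat set \<Rightarrow> real" where "inj b"
    using nat_sets_eqpoll_reals by (meson bij_betw_imp_inj_on eqpoll_def)
  ultimately have "inj_on (b \<circ> h) (mspace X)"
    by (meson comp_inj_on inj_on_subset subset_UNIV)
  then obtain Y :: "real metric" where "isometric X Y"
    unfolding isometric_def by (rule isometric_pushforward) blast
  then show ?thesis
    using that compact_metric_isometric[OF X] by blast
qed

lemma gh_dist_le_hausdorff_dist:
  fixes Z :: "'a metric"
  assumes f: "isometric_injection X Z f" and g: "isometric_injection Y Z g"
  shows "gh_dist X Y \<le> hausdorff_dist Z (f ` mspace X) (g ` mspace Y)"
proof -
  let ?A = "f ` mspace X" and ?B = "g ` mspace Y"
  have AB: "?A \<union> ?B \<subseteq> mspace Z"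
    using f g by (auto simp: isometric_injection_def)
  define Z' where "Z' = submetric Z (?A \<union> ?B)"
  have Z': "mspace Z' = ?A \<union> ?B" "mdist Z' = mdist Z"
    using AB by (auto simp: Z'_def)
  define h :: "'a \<Rightarrow> real" where
    "h z = (if z \<in> ?A then exp (inv_into (mspace X) f z) else - exp (inv_into (mspace Y) g z))" for z
  have "inj_on h (mspace Z')"
  proof (rule inj_onI)
    fix u v assume uv: "u \<in> mspace Z'" "v \<in> mspace Z'" "h u = h v"
    have "exp a \<noteq> - exp b" for a b :: real
      using exp_gt_zero[of a] exp_gt_zero[of b] by linarith
    with uv show "u = v"
      unfolding h_def Z'(1) by (auto split: if_splits dest: inv_into_injective) (metis)+
  qed
  then obtain W :: "real metric" where W: "isometric_injection Z' W h"
    using isometric_pushforward by metis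
  have hW: "mdist W (h u) (h v) = mdist Z u v" if "u \<in> ?A \<union> ?B" "v \<in> ?A \<union> ?B" for u v
    using W that by (auto simp: isometric_injection_def Z')
  have eq: "hausdorff_dist W ((h \<circ> f) ` mspace X) ((h \<circ> g) ` mspace Y) = hausdorff_dist Z ?A ?B"
    unfolding hausdorff_dist_def by (simp add: hW)
  have "isometric_injection X Z' f" "isometric_injection Y Z' g"
    using f g by (auto simp: isometric_injection_def Z')
  then have inj: "isometric_injection X W (h \<circ> f)" "isometric_injection Y W (h \<circ> g)"
    using W isometric_injection_comp by blast+
  have lower: "min 0 (Inf {}) \<le> hausdorff_dist V A B" for V :: "real metric" and A B
  proof -
    have "min 0 (Inf {}) \<le> Inf S" if S: "\<forall>r\<in>S. 0 \<le> r" for S :: "real set"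
    proof (cases "S = {}")
      case False
      then have "0 \<le> Inf S" by (rule cInf_greatest) (use S in blast)
      then show ?thesis by linarith
    qed simp
    then show ?thesis unfolding hausdorff_dist_def by simp
  qed
  show ?thesis
    unfolding gh_dist_def eq[symmetric]
  proof (rule cInf_lower)
    show "bdd_below {hausdorff_dist Z (f ` mspace X) (g ` mspace Y) | (Z :: real metric) f g.
            isometric_injection X Z f \<and> isometric_injection Y Z g}"
      by (rule bdd_belowI[of _ "min 0 (Inf {})"]) (clarsimp simp: lower)
  qed (use inj in blast)
qed

section \<open>The Gromov--Hausdorff space\<close>

definition isometric_compact :: "real metric \<Rightarrow> real metric \<Rightarrow> bool" where
  "isometric_compact X Y \<longleftrightarrow> compact_metric X \<and> compact_metric Y \<and> isometric X Y"

definition collinear_in :: "'a metric \<Rightarrow> 'a \<Rightarrow> 'a \<Rightarrow> 'a \<Rightarrow> bool" where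
  "collinear_in X x y z \<longleftrightarrow>
     mdist X x y = mdist X y z + mdist X x z \<or>
     mdist X y z = mdist X x y + mdist X x z \<or>
     mdist X x z = mdist X x y + mdist X y z"

definition collinear_free :: "'a metric \<Rightarrow> bool" where
  "collinear_free X \<longleftrightarrow>
     (\<forall>x\<in>mspace X. \<forall>y\<in>mspace X. \<forall>z\<in>mspace X.
        x \<noteq> y \<and> y \<noteq> z \<and> x \<noteq> z \<longrightarrow> \<not> collinear_in X x y z)"

lemma collinear_free_isometric:
  assumes "isometric X Y"
  shows "collinear_free X \<longleftrightarrow> collinear_free Y"
proof -
  have *: "collinear_free X" if "isometric X Y" "collinear_free Y"
    for X :: "'c metric" and Y :: "'d metric"
  proof -
    obtain f where f: "isometric_injection X Y f"
      using \<open>isometric X Y\<close> unfolding isometric_def by blast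
    have inj: "inj_on f (mspace X)"
      using f by (rule isometric_injection_inj_on)
    have fY: "f x \<in> mspace Y" if "x \<in> mspace X" for x
      using f that by (auto simp: isometric_injection_def)
    have d: "mdist X x y = mdist Y (f x) (f y)" if "x \<in> mspace X" "y \<in> mspace X" for x y
      using f that by (simp add: isometric_injection_def)
    show ?thesis
      unfolding collinear_free_def
    proof (intro ballI impI)
      fix x y z
      assume xyz: "x \<in> mspace X" "y \<in> mspace X" "z \<in> mspace X" and ne: "x \<noteq> y \<and> y \<noteq> z \<and> x \<noteq> z"
      have "f x \<noteq> f y \<and> f y \<noteq> f z \<and> f x \<noteq> f z"
        using ne inj_on_eq_iff[OF inj] xyz by simp
      then have "\<not> collinear_in Y (f x) (f y) (f z)"
        using that(2) fY xyz unfolding collinear_free_def by simp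
      then show "\<not> collinear_in X x y z"
        using d xyz unfolding collinear_in_def by simp
    qed
  qed
  show ?thesis using *[OF assms] *[OF isometric_sym[OF assms]] by blast
qed

lemma ex_compact_metric: "\<exists>X :: real metric. compact_metric X"
proof -
  interpret Metric_space "{0::real}" "\<lambda>x y. dist x y"
    by unfold_locales (auto simp: dist_commute dist_triangle)
  have "compactin mtopology {0}"
    by (rule finite_imp_compactin) auto
  then have "compact_space mtopology"
    by (simp add: compact_space_def)
  then show ?thesis
    by (intro exI[of _ Self]) (simp add: compact_metric_def mtopology_of_def)
qed

quotient_type gh_space = "real metric" / partial: isometric_compact
proof (rule part_equivpI)
  show "\<exists>X. isometric_compact X X"
    using ex_compact_metric isometric_refl unfolding isometric_compact_def by blast
qed (auto simp: symp_def transp_def isometric_compact_def intro: isometric_sym isometric_trans)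

lift_definition GH_dist :: "gh_space \<Rightarrow> gh_space \<Rightarrow> real" is gh_dist
  by (auto simp: isometric_compact_def intro: gh_dist_isometric)

lift_definition no_three_collinear :: "gh_space \<Rightarrow> bool" is collinear_free
  by (auto simp: isometric_compact_def collinear_free_isometric)

abbreviation GH_topology :: "gh_space topology" where
  "GH_topology \<equiv> Metric_space.mtopology UNIV GH_dist"

section \<open>Baire category\<close>

definition rare_in :: "'a topology \<Rightarrow> 'a set \<Rightarrow> bool" where
  "rare_in T S \<longleftrightarrow> S \<subseteq> topspace T \<and> T interior_of (T closure_of S) = {}"

definition meager_in :: "'a topology \<Rightarrow> 'a set \<Rightarrow> bool" where
  "meager_in T S \<longleftrightarrow> (\<exists>\<R>. countable \<R> \<and> (\<forall>R\<in>\<R>. rare_in T R) \<and> S = \<Union>\<R>)"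

definition residual_in :: "'a topology \<Rightarrow> 'a set \<Rightarrow> bool" where
  "residual_in T S \<longleftrightarrow> S \<subseteq> topspace T \<and> meager_in T (topspace T - S)"

end

theory Submission
  imports Defs
begin

text \<open>
  Up to a factor 2, the Gromov--Hausdorff distance is the least distortion of a correspondence.
  Given \<open>X\<close>, take a finite \<open>\<epsilon>\<close>-net and add \<open>\<epsilon>\<close> to every nonzero distance: the result is a finite
  space near \<open>X\<close> in which every triangle inequality between distinct points has slack at least
  \<open>\<epsilon>\<close>. Slack survives correspondences of small distortion, so a neighbourhood of this finite space
  contains no space with three collinear points at mutual distances at least \<open>1 / (n + 1)\<close>. For
  each \<open>n\<close>, the spaces with such a triple therefore form a rare set, and the union of these sets
  over \<open>n\<close> is the complement of the set in question.
\<close>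

section \<open>Correspondences\<close>

text \<open>\<open>r\<close> is an upper bound for the distortion, not its exact value, so no
  supremum has to be formed and bounds may be weakened freely.\<close>

definition correspondence :: "'a metric \<Rightarrow> 'b metric \<Rightarrow> real \<Rightarrow> ('a \<times> 'b) set \<Rightarrow> bool" where
  "correspondence X Y r R \<longleftrightarrow>
     R \<subseteq> mspace X \<times> mspace Y \<and>
     (\<forall>x\<in>mspace X. \<exists>y. (x, y) \<in> R) \<and> (\<forall>y\<in>mspace Y. \<exists>x. (x, y) \<in> R) \<and>
     (\<forall>a b a' b'. (a, b) \<in> R \<longrightarrow> (a', b') \<in> R \<longrightarrow> \<bar>mdist X a a' - mdist Y b b'\<bar> \<le> r)"

lemma correspondenceI:
  assumes "\<And>a b. (a, b) \<in> R \<Longrightarrow> a \<in> mspace X" "\<And>a b. (a, b) \<in> R \<Longrightarrow> b \<in> mspace Y"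
    and "\<And>x. x \<in> mspace X \<Longrightarrow> \<exists>y. (x, y) \<in> R" "\<And>y. y \<in> mspace Y \<Longrightarrow> \<exists>x. (x, y) \<in> R"
    and "\<And>a b a' b'. \<lbrakk>(a, b) \<in> R; (a', b') \<in> R\<rbrakk> \<Longrightarrow> \<bar>mdist X a a' - mdist Y b b'\<bar> \<le> r"
  shows "correspondence X Y r R"
  unfolding correspondence_def
  by (intro conjI subrelI SigmaI ballI allI impI) (rule assms; assumption)+

lemma correspondenceD:
  assumes "correspondence X Y r R"
  shows "(a, b) \<in> R \<Longrightarrow> a \<in> mspace X" "(a, b) \<in> R \<Longrightarrow> b \<in> mspace Y"
    and "x \<in> mspace X \<Longrightarrow> \<exists>y. (x, y) \<in> R" "y \<in> mspace Y \<Longrightarrow> \<exists>x. (x, y) \<in> R"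
    and "\<lbrakk>(a, b) \<in> R; (a', b') \<in> R\<rbrakk> \<Longrightarrow> \<bar>mdist X a a' - mdist Y b b'\<bar> \<le> r"
  using assms by (auto simp: correspondence_def)

lemma correspondence_converse:
  "correspondence X Y r R \<Longrightarrow> correspondence Y X r (R\<inverse>)"
  unfolding correspondence_def by (auto simp: abs_minus_commute)

text \<open>Inserting the intermediate distance in \<open>Y\<close> makes the distortions add. This
  becomes the triangle inequality for \<open>gh_dist\<close>.\<close>

lemma correspondence_relcomp:
  assumes R: "correspondence X Y r R" and S: "correspondence Y Z s S"
  shows "correspondence X Z (r + s) (R O S)"
proof (rule correspondenceI)
  show "a \<in> mspace X" "c \<in> mspace Z" if "(a, c) \<in> R O S" for a c
    using that correspondenceD(1)[OF R] correspondenceD(2)[OF S] by blast+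
next
  fix x assume "x \<in> mspace X"
  then obtain y where y: "(x, y) \<in> R"
    using correspondenceD(3)[OF R] by blast
  obtain z where "(y, z) \<in> S"
    using correspondenceD(3)[OF S correspondenceD(2)[OF R y]] by blast
  then show "\<exists>z. (x, z) \<in> R O S" using y by blast
next
  fix z assume "z \<in> mspace Z"
  then obtain y where y: "(y, z) \<in> S"
    using correspondenceD(4)[OF S] by blast
  obtain x where "(x, y) \<in> R"
    using correspondenceD(4)[OF R correspondenceD(1)[OF S y]] by blast
  then show "\<exists>x. (x, z) \<in> R O S" using y by blast
next
  fix a c a' c'
  assume "(a, c) \<in> R O S" "(a', c') \<in> R O S"
  then obtain b b' where "(a, b) \<in> R" "(b, c) \<in> S" "(a', b') \<in> R" "(b', c') \<in> S"
    by blast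
  then show "\<bar>mdist X a a' - mdist Z c c'\<bar> \<le> r + s"
    using correspondenceD(5)[OF R, of a b a' b'] correspondenceD(5)[OF S, of b c b' c'] by linarith
qed

lemma compact_metric_bounded:
  assumes "compact_metric X"
  obtains B where "\<And>x y. \<lbrakk>x \<in> mspace X; y \<in> mspace X\<rbrakk> \<Longrightarrow> mdist X x y \<le> B"
proof -
  interpret Metric_space "mspace X" "mdist X" by simp
  have "compactin mtopology (mspace X)"
    using assms by (simp add: compact_metric_def mtopology_of_def compact_space_def)
  then have "mbounded (mspace X)"
    by (rule compactin_imp_mbounded)
  then show ?thesis
    using that unfolding mbounded_alt by meson
qed

text \<open>Compactness bounds both metrics, so even the full product has finite distortion. This
  starts the construction of a common ambient space.\<close>

lemma ex_correspondence:
  assumes X: "compact_metric X" and Y: "compact_metric Y"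
  obtains r where "correspondence X Y r (mspace X \<times> mspace Y)"
proof -
  obtain B where B: "\<And>x y. \<lbrakk>x \<in> mspace X; y \<in> mspace X\<rbrakk> \<Longrightarrow> mdist X x y \<le> B"
    using compact_metric_bounded[OF X] by blast
  obtain C where C: "\<And>x y. \<lbrakk>x \<in> mspace Y; y \<in> mspace Y\<rbrakk> \<Longrightarrow> mdist Y x y \<le> C"
    using compact_metric_bounded[OF Y] by blast
  have "correspondence X Y (B + C) (mspace X \<times> mspace Y)"
  proof (rule correspondenceI)
    fix a b a' b'
    assume "(a, b) \<in> mspace X \<times> mspace Y" "(a', b') \<in> mspace X \<times> mspace Y"
    then have "mdist X a a' \<le> B" "mdist Y b b' \<le> C"
      using B C by auto
    then show "\<bar>mdist X a a' - mdist Y b b'\<bar> \<le> B + C"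
      using mdist_nonneg[of X a a'] mdist_nonneg[of Y b b'] by linarith
  qed (use X Y in \<open>auto simp: compact_metric_def\<close>)
  then show ?thesis by (rule that)
qed

section \<open>Gluing two spaces along a correspondence\<close>

lemma hausdorff_dist_le:
  assumes "0 \<le> r" "\<And>a. a \<in> A \<Longrightarrow> \<exists>b\<in>B. mdist Z a b \<le> r" "\<And>b. b \<in> B \<Longrightarrow> \<exists>a\<in>A. mdist Z a b \<le> r"
  shows "hausdorff_dist Z A B \<le> r"
  unfolding hausdorff_dist_def
  by (rule cInf_lower) (use assms in \<open>auto intro!: bdd_belowI[of _ 0]\<close>)

text \<open>
  On the disjoint union, the distance from \<open>x\<close> to \<open>y\<close> is \<open>r\<close> plus the infimum \<open>c x y\<close> of
  \<open>d(x, a) + d(b, y)\<close> over all \<open>(a, b) \<in> R\<close>. A path that crosses over and returns costs at least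
  \<open>2 * r\<close>, which absorbs the distortion of \<open>R\<close>.
\<close>

lemma correspondence_glue:
  fixes X :: "'a metric" and Y :: "'b metric"
  assumes R: "correspondence X Y (2 * r) R" and r: "r > 0" and X: "mspace X \<noteq> {}"
  obtains Z :: "('a + 'b) metric"
  where "isometric_injection X Z Inl" "isometric_injection Y Z Inr"
    "hausdorff_dist Z (Inl ` mspace X) (Inr ` mspace Y) \<le> r"
proof -
  define S where "S x y = (\<lambda>(a, b). mdist X x a + mdist Y b y) ` R" for x y
  define c where "c x y = Inf (S x y)" for x y
  \<comment> \<open>A point of \<open>X\<close> has a partner, so \<open>R\<close> is nonempty and
    the infimum \<open>c\<close> is a genuine one.\<close>
  have S_ne: "S x y \<noteq> {}" for x y
    using X correspondenceD(3)[OF R] unfolding S_def by blast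
  have c_le: "c x y \<le> mdist X x a + mdist Y b y" if "(a, b) \<in> R" for x y a b
    unfolding c_def
    by (rule cInf_lower) (use that in \<open>auto simp: S_def intro!: bdd_belowI[of _ 0]\<close>)
  have c_ge: "l \<le> c x y" if "\<And>a b. (a, b) \<in> R \<Longrightarrow> l \<le> mdist X x a + mdist Y b y" for l x y
    unfolding c_def by (rule cInf_greatest) (use that S_ne in \<open>auto simp: S_def\<close>)
  have c_nonneg: "0 \<le> c x y" for x y
    by (rule c_ge) simp
  have RX: "a \<in> mspace X" and RY: "b \<in> mspace Y" if "(a, b) \<in> R" for a b
    using correspondenceD(1,2)[OF R that] by auto
  have c_tri1: "c x y \<le> mdist X x x' + c x' y" if "x \<in> mspace X" "x' \<in> mspace X" for x x' y
  proof -
    have "c x y - mdist X x x' \<le> c x' y"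
    proof (rule c_ge)
      show "c x y - mdist X x x' \<le> mdist X x' a + mdist Y b y" if ab: "(a, b) \<in> R" for a b
        using c_le[OF ab, of x y] mdist_triangle[of x X x' a] RX[OF ab]
          \<open>x \<in> mspace X\<close> \<open>x' \<in> mspace X\<close> by linarith
    qed
    then show ?thesis by linarith
  qed
  have c_tri2: "c x y \<le> c x y' + mdist Y y' y" if "y \<in> mspace Y" "y' \<in> mspace Y" for x y y'
  proof -
    have "c x y - mdist Y y' y \<le> c x y'"
    proof (rule c_ge)
      show "c x y - mdist Y y' y \<le> mdist X x a + mdist Y b y'" if ab: "(a, b) \<in> R" for a b
        using c_le[OF ab, of x y] mdist_triangle[of b Y y' y] RY[OF ab]
          \<open>y \<in> mspace Y\<close> \<open>y' \<in> mspace Y\<close> by linarith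
    qed
    then show ?thesis by linarith
  qed
  have c_triX: "mdist X x x' \<le> 2 * r + c x y + c x' y"
    if xy: "x \<in> mspace X" "x' \<in> mspace X" "y \<in> mspace Y" for x x' y
  proof -
    \<comment> \<open>The two infima are treated one after the other: a pair is fixed for
      \<open>c x y\<close>, then a second one for \<open>c x' y\<close>.\<close>
    have "mdist X x x' - 2 * r - c x' y \<le> c x y"
    proof (rule c_ge)
      fix a b assume ab: "(a, b) \<in> R"
      have "mdist X x x' - 2 * r - (mdist X x a + mdist Y b y) \<le> c x' y"
      proof (rule c_ge)
        fix a' b' assume ab': "(a', b') \<in> R"
        show "mdist X x x' - 2 * r - (mdist X x a + mdist Y b y) \<le> mdist X x' a' + mdist Y b' y"
          \<comment> \<open>Go from \<open>x\<close> to \<open>x'\<close> through \<open>a\<close>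
            and \<open>a'\<close>. By the distortion bound, d(a, a') is at most d(b, b') + 2 * r,
            and d(b, b') is estimated through \<open>y\<close>.\<close>
          using mdist_triangle[of x X a x'] mdist_triangle[of a X a' x'] mdist_triangle[of b Y y b']
            correspondenceD(5)[OF R ab ab'] RX[OF ab] RX[OF ab'] RY[OF ab] RY[OF ab'] xy
            mdist_commute[of X x' a'] mdist_commute[of Y b' y] by linarith
      qed
      then show "mdist X x x' - 2 * r - c x' y \<le> mdist X x a + mdist Y b y" by linarith
    qed
    then show ?thesis by linarith
  qed
  have c_triY: "mdist Y y y' \<le> 2 * r + c x y + c x y'"
    if xy: "y \<in> mspace Y" "y' \<in> mspace Y" "x \<in> mspace X" for x y y'
  proof -
    have "mdist Y y y' - 2 * r - c x y' \<le> c x y"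
    proof (rule c_ge)
      fix a b assume ab: "(a, b) \<in> R"
      have "mdist Y y y' - 2 * r - (mdist X x a + mdist Y b y) \<le> c x y'"
      proof (rule c_ge)
        fix a' b' assume ab': "(a', b') \<in> R"
        show "mdist Y y y' - 2 * r - (mdist X x a + mdist Y b y) \<le> mdist X x a' + mdist Y b' y'"
          using mdist_triangle[of y Y b y'] mdist_triangle[of b Y b' y'] mdist_triangle[of a X x a']
            correspondenceD(5)[OF R ab ab'] RX[OF ab] RX[OF ab'] RY[OF ab] RY[OF ab'] xy
            mdist_commute[of X x a] mdist_commute[of Y b y] by linarith
      qed
      then show "mdist Y y y' - 2 * r - c x y' \<le> mdist X x a + mdist Y b y" by linarith
    qed
    then show ?thesis by linarith
  qed
  define d where "d u v = (case u of
      Inl x \<Rightarrow> (case v of Inl x' \<Rightarrow> mdist X x x' | Inr y \<Rightarrow> r + c x y)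
    | Inr y \<Rightarrow> (case v of Inl x \<Rightarrow> r + c x y | Inr y' \<Rightarrow> mdist Y y y'))" for u v
  have d_simps [simp]:
    "d (Inl x) (Inl x') = mdist X x x'" "d (Inr y) (Inr y') = mdist Y y y'"
    "d (Inl x) (Inr y) = r + c x y" "d (Inr y) (Inl x) = r + c x y" for x x' y y'
    by (simp_all add: d_def)
  interpret Metric_space "mspace X <+> mspace Y" d
  proof
    fix u v
    show "0 \<le> d u v"
      using r c_nonneg by (cases u; cases v) (auto intro: add_nonneg_nonneg)
    show "d u v = d v u"
      by (cases u; cases v) (auto simp: mdist_commute)
  next
    fix u v assume "u \<in> mspace X <+> mspace Y" "v \<in> mspace X <+> mspace Y"
    \<comment> \<open>\<open>c\<close> may vanish; the positive summand \<open>r\<close> is what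
      keeps points of the two sides apart.\<close>
    moreover have "r + c x y \<noteq> 0" for x y
      using r c_nonneg[of x y] by linarith
    ultimately show "d u v = 0 \<longleftrightarrow> u = v" by auto
  next
    fix u v w
    assume "u \<in> mspace X <+> mspace Y" "v \<in> mspace X <+> mspace Y" "w \<in> mspace X <+> mspace Y"
    \<comment> \<open>Eight cases by sides. \<open>c_tri1\<close> and \<open>c_tri2\<close> settle
      those with \<open>u\<close> and \<open>w\<close> on different sides, \<open>c_triX\<close> and
      \<open>c_triY\<close> those where only \<open>v\<close> is on the other side.\<close>
    then show "d u w \<le> d u v + d v w"
      apply (elim PlusE; simp)
             apply (simp add: mdist_triangle)
      subgoal for x y z using c_tri1[of x y z] by linarith
      subgoal for x y z using c_triX[of x z y] by linarith
      subgoal for x y z using c_tri2[of z y x] by linarith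
      subgoal for x y z using c_tri1[of z y x] mdist_commute[of X y z] by linarith
      subgoal for x y z using c_triY[of x z y] by linarith
      subgoal for x y z using c_tri2[of x y z] mdist_commute[of Y x y] by linarith
      apply (simp add: mdist_triangle)
      done
  qed
  \<comment> \<open>The pair itself competes in the infimum. Related points are thus at distance
    exactly \<open>r\<close>, which gives the Hausdorff bound.\<close>
  have cR: "c x y = 0" if xy: "(x, y) \<in> R" for x y
  proof -
    have "mdist X x x = 0" "mdist Y y y = 0"
      using RX[OF xy] RY[OF xy] by simp_all
    then show ?thesis
      using c_le[OF xy, of x y] c_nonneg[of x y] by linarith
  qed
  show ?thesis
  proof (rule that[of Self])
    show "hausdorff_dist Self (Inl ` mspace X) (Inr ` mspace Y) \<le> r"
    proof (rule hausdorff_dist_le)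
      fix u :: "'a + 'b" assume "u \<in> Inl ` mspace X"
      then obtain x where x: "x \<in> mspace X" "u = Inl x" by blast
      then obtain y where "(x, y) \<in> R" using correspondenceD(3)[OF R] by blast
      then show "\<exists>v\<in>Inr ` mspace Y. mdist Self u v \<le> r"
        using x cR RY by (intro bexI[of _ "Inr y"]) auto
    next
      fix v :: "'a + 'b" assume "v \<in> Inr ` mspace Y"
      then obtain y where y: "y \<in> mspace Y" "v = Inr y" by blast
      then obtain x where "(x, y) \<in> R" using correspondenceD(4)[OF R] by blast
      then show "\<exists>u\<in>Inl ` mspace X. mdist Self u v \<le> r"
        using y cR RX by (intro bexI[of _ "Inl x"]) auto
    qed (use r in simp)
  qed (auto simp: isometric_injection_def)
qed

text \<open>One half of the comparison up to a factor 2. The glued space lives on a sum type, which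
  \<open>gh_dist_le_hausdorff_dist\<close> admits as ambient space.\<close>

lemma gh_dist_le_correspondence:
  assumes R: "correspondence X Y (2 * r) R" and r: "r > 0" and X: "mspace X \<noteq> {}"
  shows "gh_dist X Y \<le> r"
proof -
  obtain Z :: "(real + real) metric"
    where Z: "isometric_injection X Z Inl" "isometric_injection Y Z Inr"
      "hausdorff_dist Z (Inl ` mspace X) (Inr ` mspace Y) \<le> r"
    using correspondence_glue[OF R r X] by blast
  show ?thesis
    using gh_dist_le_hausdorff_dist[OF Z(1,2)] Z(3) by linarith
qed

section \<open>From small Gromov-Hausdorff distance to correspondences\<close>

lemma correspondence_mono:
  "\<lbrakk>correspondence X Y r R; r \<le> s\<rbrakk> \<Longrightarrow> correspondence X Y s R"
  unfolding correspondence_def by fastforce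

text \<open>Ensures that the infimum defining \<open>gh_dist\<close> ranges over a nonempty set,
  since \<open>Inf {}\<close> carries no information.\<close>

lemma ex_common_ambient:
  fixes X Y :: "real metric"
  assumes X: "compact_metric X" and Y: "compact_metric Y"
  shows "\<exists>(Z :: real metric) f g. isometric_injection X Z f \<and> isometric_injection Y Z g"
proof -
  obtain r where r: "correspondence X Y r (mspace X \<times> mspace Y)"
    using ex_correspondence[OF X Y] .
  \<comment> \<open>Gluing requires a bound of the form \<open>2 * r\<close> with \<open>r\<close>
    strictly positive.\<close>
  have "correspondence X Y (2 * (\<bar>r\<bar> + 1)) (mspace X \<times> mspace Y)"
    by (rule correspondence_mono[OF r]) (simp add: abs_if)
  then obtain Z :: "(real + real) metric"
    where Z: "isometric_injection X Z Inl" "isometric_injection Y Z Inr"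
    using correspondence_glue[of X Y "\<bar>r\<bar> + 1"] X unfolding compact_metric_def
    by (metis abs_add_one_gt_zero add.commute)
  \<comment> \<open>The sum embeds into the reals: the two halves go to the positive and the
    negative numbers.\<close>
  define h :: "real + real \<Rightarrow> real" where "h = case_sum exp (\<lambda>y. - exp y)"
  have "exp a \<noteq> - exp b" for a b :: real
    using exp_gt_zero[of a] exp_gt_zero[of b] by linarith
  then have "h u = h v \<Longrightarrow> u = v" for u v
    by (cases u; cases v) (auto simp: h_def dest: sym)
  then have "inj_on h (mspace Z)"
    by (simp add: inj_on_def)
  then obtain W :: "real metric" where "isometric_injection Z W h"
    using isometric_pushforward by metis
  then show ?thesis
    using isometric_injection_comp[OF Z(1)] isometric_injection_comp[OF Z(2)] by blast
qed

text \<open>The content is that the set under the infimum is nonempty, which follows from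
  boundedness; then some admissible \<open>s\<close> lies below \<open>r\<close>.\<close>

lemma hausdorff_dist_lessD:
  assumes X: "compact_metric X" and Y: "compact_metric Y"
    and f: "isometric_injection X Z f" and g: "isometric_injection Y Z g"
    and less: "hausdorff_dist Z (f ` mspace X) (g ` mspace Y) < r"
  obtains s where "0 \<le> s" "s < r" "\<And>x. x \<in> mspace X \<Longrightarrow> \<exists>y\<in>mspace Y. mdist Z (f x) (g y) \<le> s"
    "\<And>y. y \<in> mspace Y \<Longrightarrow> \<exists>x\<in>mspace X. mdist Z (f x) (g y) \<le> s"
proof -
  let ?S = "{r. 0 \<le> r \<and> (\<forall>a\<in>f ` mspace X. \<exists>b\<in>g ` mspace Y. mdist Z a b \<le> r) \<and>
      (\<forall>b\<in>g ` mspace Y. \<exists>a\<in>f ` mspace X. mdist Z a b \<le> r)}"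
  obtain B where B: "\<And>x y. \<lbrakk>x \<in> mspace X; y \<in> mspace X\<rbrakk> \<Longrightarrow> mdist X x y \<le> B"
    using compact_metric_bounded[OF X] by blast
  obtain C where C: "\<And>x y. \<lbrakk>x \<in> mspace Y; y \<in> mspace Y\<rbrakk> \<Longrightarrow> mdist Y x y \<le> C"
    using compact_metric_bounded[OF Y] by blast
  obtain x0 y0 where xy0: "x0 \<in> mspace X" "y0 \<in> mspace Y"
    using X Y unfolding compact_metric_def by blast
  \<comment> \<open>Bounds every distance between the two images, by way of \<open>f x0\<close> and
    \<open>g y0\<close>.\<close>
  define D where "D = B + mdist Z (f x0) (g y0) + C"
  have fZ: "f x \<in> mspace Z" if "x \<in> mspace X" for x
    using f that by (auto simp: isometric_injection_def)
  have gZ: "g y \<in> mspace Z" if "y \<in> mspace Y" for y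
    using g that by (auto simp: isometric_injection_def)
  have D: "mdist Z (f x) (g y) \<le> D" if "x \<in> mspace X" "y \<in> mspace Y" for x y
  proof -
    have "mdist Z (f x) (f x0) \<le> B" "mdist Z (g y0) (g y) \<le> C"
      using B C f g that xy0 by (auto simp: isometric_injection_def)
    then show ?thesis
      using mdist_triangle[of "f x" Z "f x0" "g y"] mdist_triangle[of "f x0" Z "g y0" "g y"]
        fZ gZ that xy0 unfolding D_def by fastforce
  qed
  have "0 \<le> D"
    using D[OF xy0] mdist_nonneg[of Z "f x0" "g y0"] by linarith
  then have "D \<in> ?S"
    using D xy0 by auto
  then have "?S \<noteq> {}" by blast
  then obtain s where "s \<in> ?S" "s < r"
    using cInf_lessD[of ?S r] less unfolding hausdorff_dist_def by blast
  then show ?thesis using that[of s] by auto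
qed

text \<open>The other half of the comparison: points whose images are at distance at most
  \<open>s < r\<close> are related, and moving both endpoints changes a distance by at most
  \<open>2 * s\<close>.\<close>

lemma gh_dist_lessD:
  assumes X: "compact_metric X" and Y: "compact_metric Y" and less: "gh_dist X Y < r"
  obtains R where "correspondence X Y (2 * r) R" "r > 0"
proof -
  have "{hausdorff_dist Z (f ` mspace X) (g ` mspace Y) | (Z :: real metric) f g.
      isometric_injection X Z f \<and> isometric_injection Y Z g} \<noteq> {}"
    using ex_common_ambient[OF X Y] by blast
  then obtain Z :: "real metric" and f g where
    f: "isometric_injection X Z f" and g: "isometric_injection Y Z g" and
    fg: "hausdorff_dist Z (f ` mspace X) (g ` mspace Y) < r"
    using less cInf_lessD unfolding gh_dist_def by (smt (verit) mem_Collect_eq)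
  obtain s where s: "0 \<le> s" "s < r" "\<And>x. x \<in> mspace X \<Longrightarrow> \<exists>y\<in>mspace Y. mdist Z (f x) (g y) \<le> s"
    "\<And>y. y \<in> mspace Y \<Longrightarrow> \<exists>x\<in>mspace X. mdist Z (f x) (g y) \<le> s"
    using hausdorff_dist_lessD[OF X Y f g fg] by blast
  have "correspondence X Y (2 * r) {(x, y). x \<in> mspace X \<and> y \<in> mspace Y \<and> mdist Z (f x) (g y) \<le> s}"
  proof (rule correspondenceI, goal_cases)
    case (5 a b a' b')
    then have *: "mdist Z (f a) (g b) \<le> s" "mdist Z (f a') (g b') \<le> s" by auto
    have "f a \<in> mspace Z" "f a' \<in> mspace Z" "g b \<in> mspace Z" "g b' \<in> mspace Z"
      using f g 5 by (auto simp: isometric_injection_def)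
    then have "\<bar>mdist Z (f a) (f a') - mdist Z (g b) (g b')\<bar> \<le> 2 * r"
      using mdist_triangle[of "f a" Z "g b" "f a'"] mdist_triangle[of "g b" Z "g b'" "f a'"]
        mdist_triangle[of "g b" Z "f a" "g b'"] mdist_triangle[of "f a" Z "f a'" "g b'"]
        mdist_commute[of Z "g b" "f a"] mdist_commute[of Z "g b'" "f a'"] * s(2) by linarith
    then show ?case
      using f g 5 by (auto simp: isometric_injection_def)
  qed (use s in blast)+
  then show ?thesis
    using s by (intro that) auto
qed

section \<open>The Gromov--Hausdorff metric\<close>

lemma gh_dist_nonneg:
  assumes "compact_metric X" "compact_metric Y"
  shows "0 \<le> gh_dist X Y"
proof (rule ccontr)
  assume "\<not> 0 \<le> gh_dist X Y"
  then have "gh_dist X Y < 0" by simp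
  \<comment> \<open>\<open>gh_dist_lessD\<close> is used with bound 0, where its conclusion
    \<open>r > 0\<close> is absurd.\<close>
  then show False
    by (rule gh_dist_lessD[OF assms]) simp
qed

lemma gh_dist_commute_le:
  assumes X: "compact_metric X" and Y: "compact_metric Y"
  shows "gh_dist X Y \<le> gh_dist Y X"
proof (rule dense_ge)
  fix r assume "gh_dist Y X < r"
  then obtain R where "correspondence Y X (2 * r) R" "r > 0"
    using gh_dist_lessD[OF Y X] by blast
  then show "gh_dist X Y \<le> r"
    using gh_dist_le_correspondence[OF correspondence_converse] X
    unfolding compact_metric_def by blast
qed

lemma gh_dist_triangle:
  assumes X: "compact_metric X" and Y: "compact_metric Y" and Z: "compact_metric Z"
  shows "gh_dist X Z \<le> gh_dist X Y + gh_dist Y Z"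
proof (rule field_le_epsilon)
  fix e :: real assume e: "e > 0"
  define r s where "r = gh_dist X Y + e / 2" and "s = gh_dist Y Z + e / 2"
  have "gh_dist X Y < r" "gh_dist Y Z < s"
    using e by (auto simp: r_def s_def)
  then obtain R S where R: "correspondence X Y (2 * r) R" "r > 0"
    and S: "correspondence Y Z (2 * s) S" "s > 0"
    using gh_dist_lessD[OF X Y] gh_dist_lessD[OF Y Z] by metis
  have "correspondence X Z (2 * (r + s)) (R O S)"
    using correspondence_relcomp[OF R(1) S(1)] by (simp add: algebra_simps)
  then have "gh_dist X Z \<le> r + s"
    by (rule gh_dist_le_correspondence) (use R S X in \<open>auto simp: compact_metric_def\<close>)
  then show "gh_dist X Z \<le> gh_dist X Y + gh_dist Y Z + e"
    by (simp add: r_def s_def)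
qed

section \<open>Distance zero forces isometry\<close>

lemma compact_space_cluster_point:
  fixes F :: "nat \<Rightarrow> 'a"
  assumes T: "compact_space T" and F: "\<And>n. F n \<in> topspace T"
  obtains p where "p \<in> topspace T" "\<And>U N. \<lbrakk>openin T U; p \<in> U\<rbrakk> \<Longrightarrow> \<exists>n\<ge>N. F n \<in> U"
proof -
  \<comment> \<open>Closures of tails are nested, nonempty and closed; a common point is a cluster
    point.\<close>
  define C where "C N = T closure_of (F ` {N..})" for N
  have "F N \<in> C N" for N
    using F closure_of_subset[of "F ` {N..}" T] unfolding C_def by blast
  then have "C N \<noteq> {}" for N by blast
  moreover have "decseq C"
    unfolding C_def decseq_def by (intro allI impI closure_of_mono) auto
  ultimately have "(\<Inter>n. C n) \<noteq> {}"
    by (intro compact_space_imp_nest[OF T]) (simp_all add: C_def[abs_def])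
  then obtain p where p: "\<And>N. p \<in> C N" by blast
  show ?thesis
  proof (rule that)
    show "p \<in> topspace T"
      using p[of 0] unfolding C_def in_closure_of by blast
    show "\<exists>n\<ge>N. F n \<in> U" if "openin T U" "p \<in> U" for U N
      using p[of N] that unfolding C_def in_closure_of by fastforce
  qed
qed

lemma openin_mtopology_of_ball:
  assumes "a \<in> mspace X"
  shows "openin (mtopology_of X) {y \<in> mspace X. mdist X a y < e}"
proof -
  interpret Metric_space "mspace X" "mdist X" by simp
  have "{y \<in> mspace X. mdist X a y < e} = mball a e"
    using assms by (auto simp: mball_def)
  then show ?thesis by (simp add: mtopology_of_def)
qed

text \<open>Tychonoff's theorem in metric terms. A cluster point replaces a convergent subsequence
  because a product of uncountably many factors need not be sequentially compact.\<close>

lemma product_cluster_point: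
  fixes X :: "'i \<Rightarrow> 'a metric" and F :: "nat \<Rightarrow> 'i \<Rightarrow> 'a"
  assumes X: "\<And>i. i \<in> I \<Longrightarrow> compact_space (mtopology_of (X i))"
    and F: "\<And>n i. i \<in> I \<Longrightarrow> F n i \<in> mspace (X i)"
  shows "\<exists>p. (\<forall>i\<in>I. p i \<in> mspace (X i)) \<and>
    (\<forall>J e N. finite J \<and> J \<subseteq> I \<and> e > 0 \<longrightarrow> (\<exists>n\<ge>N. \<forall>i\<in>J. mdist (X i) (p i) (F n i) < e))"
proof -
  let ?T = "product_topology (\<lambda>i. mtopology_of (X i)) I"
  \<comment> \<open>Points of the product topology are extensional functions.\<close>
  define G where "G n = restrict (F n) I" for n
  have "compact_space ?T"
    using X by (simp add: compact_space_product_topology)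
  moreover have "G n \<in> topspace ?T" for n
    using F by (auto simp: G_def)
  ultimately obtain p where p: "p \<in> topspace ?T"
    and cluster: "\<And>U N. \<lbrakk>openin ?T U; p \<in> U\<rbrakk> \<Longrightarrow> \<exists>n\<ge>N. G n \<in> U"
    using compact_space_cluster_point[of ?T G] by blast
  have pX: "p i \<in> mspace (X i)" if "i \<in> I" for i
    using p that by (auto simp: PiE_iff)
  show ?thesis
  proof (intro exI[of _ p] conjI ballI pX allI impI)
    fix J and e :: real and N
    assume "finite J \<and> J \<subseteq> I \<and> e > 0"
    then have J: "finite J" "J \<subseteq> I" and e: "e > 0" by auto
    define U where "U i = {q \<in> topspace ?T. q i \<in> {y \<in> mspace (X i). mdist (X i) (p i) y < e}}" for i
    have U: "openin ?T (U i)" if "i \<in> I" for i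
      unfolding U_def
      by (rule openin_continuous_map_preimage[OF continuous_map_product_projection[OF that]])
        (rule openin_mtopology_of_ball[OF pX[OF that]])
    \<comment> \<open>For empty \<open>J\<close> the inner intersection is \<open>UNIV\<close>,
      hence the factor \<open>topspace ?T\<close>.\<close>
    have "openin ?T (topspace ?T \<inter> (\<Inter>i\<in>J. U i))"
    proof (cases "J = {}")
      case False
      with J show ?thesis
        by (intro openin_Int openin_topspace openin_INT2) (auto intro: U)
    qed (simp only: INT_empty Int_UNIV_right openin_topspace image_empty Inter_empty)
    moreover have "p \<in> topspace ?T \<inter> (\<Inter>i\<in>J. U i)"
    proof -
      have "mdist (X i) (p i) (p i) = 0" if "i \<in> J" for i
        using pX J that by (simp add: subset_iff)
      then show ?thesis
        using p pX e J by (auto simp: U_def)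
    qed
    ultimately obtain n where n: "n \<ge> N" "G n \<in> topspace ?T \<inter> (\<Inter>i\<in>J. U i)"
      using cluster by meson
    have "mdist (X i) (p i) (F n i) < e" if "i \<in> J" for i
    proof -
      have "i \<in> I" using J that by blast
      then show ?thesis using n(2) that by (auto simp: U_def G_def)
    qed
    then show "\<exists>n\<ge>N. \<forall>i\<in>J. mdist (X i) (p i) (F n i) < e"
      using n(1) by blast
  qed
qed

text \<open>
  Selections \<open>f\<^sub>n : X \<rightarrow> Y\<close> and \<open>g\<^sub>n : Y \<rightarrow> X\<close> of correspondences with distortion tending to 0 have
  a common cluster point \<open>(f, g)\<close> for pointwise convergence, by Tychonoff's theorem. Then \<open>f\<close>
  preserves distances, and \<open>f (g y) = y\<close> makes it surjective.
\<close>

lemma isometric_if_correspondences: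
  fixes X Y :: "'a metric"
  assumes X: "compact_metric X" and Y: "compact_metric Y"
    and R: "\<And>r. r > 0 \<Longrightarrow> \<exists>R. correspondence X Y r R"
  shows "isometric X Y"
proof -
  have "\<exists>R. correspondence X Y (1 / Suc n) R" for n
    by (rule R) simp
  then obtain R where R: "\<And>n. correspondence X Y (1 / Suc n) (R n)"
    using choice[of "\<lambda>n. correspondence X Y (1 / Suc n)"] by blast
  define f where "f n x = (SOME y. (x, y) \<in> R n)" for n x
  define g where "g n y = (SOME x. (x, y) \<in> R n)" for n y
  have f: "(x, f n x) \<in> R n" if "x \<in> mspace X" for n x
    unfolding f_def by (rule someI_ex[OF correspondenceD(3)[OF R that]])
  have g: "(g n y, y) \<in> R n" if "y \<in> mspace Y" for n y
    unfolding g_def by (rule someI_ex[OF correspondenceD(4)[OF R that]])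
  \<comment> \<open>A single product for both families of maps, so that the same \<open>n\<close>
    approximates values of \<open>f'\<close> and of \<open>g'\<close>.\<close>
  define I where "I = mspace X <+> mspace Y"
  define V :: "'a + 'a \<Rightarrow> 'a metric" where "V = case_sum (\<lambda>_. Y) (\<lambda>_. X)"
  define F where "F n = case_sum (f n) (g n)" for n
  have "compact_space (mtopology_of (V i))" if "i \<in> I" for i
    using X Y by (cases i) (auto simp: V_def compact_metric_def)
  moreover have "F n i \<in> mspace (V i)" if "i \<in> I" for n i
    using that correspondenceD(2)[OF R f] correspondenceD(1)[OF R g]
    by (auto simp: I_def V_def F_def)
  ultimately have "\<exists>p. (\<forall>i\<in>I. p i \<in> mspace (V i)) \<and>
    (\<forall>J e N. finite J \<and> J \<subseteq> I \<and> e > 0 \<longrightarrow> (\<exists>n\<ge>N. \<forall>i\<in>J. mdist (V i) (p i) (F n i) < e))"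
    by (rule product_cluster_point)
  then obtain p where p: "\<forall>i\<in>I. p i \<in> mspace (V i)"
    and cluster: "\<forall>J e N. finite J \<and> J \<subseteq> I \<and> e > 0 \<longrightarrow>
      (\<exists>n\<ge>N. \<forall>i\<in>J. mdist (V i) (p i) (F n i) < e)"
    by (elim exE conjE) (rule that)
  define f' g' where "f' x = p (Inl x)" and "g' y = p (Inr y)" for x y
  have f'Y: "f' x \<in> mspace Y" if "x \<in> mspace X" for x
    using bspec[OF p, of "Inl x"] that by (auto simp: I_def V_def f'_def)
  have g'X: "g' y \<in> mspace X" if "y \<in> mspace Y" for y
    using bspec[OF p, of "Inr y"] that by (auto simp: I_def V_def g'_def)
  have fY: "f n x \<in> mspace Y" if "x \<in> mspace X" for n x
    using correspondenceD(2)[OF R f[OF that]] .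
  have gX: "g n y \<in> mspace X" if "y \<in> mspace Y" for n y
    using correspondenceD(1)[OF R g[OF that]] .
  have small: "1 / Suc n \<le> e" if "e > 0" "n \<ge> nat \<lceil>1 / e\<rceil>" for e :: real and n
  proof -
    have "1 / e \<le> Suc n" using that by linarith
    then show ?thesis using that by (simp add: field_simps)
  qed
  have dist: "mdist Y (f' x) (f' x') = mdist X x x'" if x: "x \<in> mspace X" "x' \<in> mspace X" for x x'
  proof -
    \<comment> \<open>Three errors of \<open>e / 3\<close>: replacing \<open>f'\<close> by
      \<open>f n\<close> at each of the two points, and the distortion of
      \<open>R n\<close>.\<close>
    have "\<bar>mdist Y (f' x) (f' x') - mdist X x x'\<bar> \<le> e" if e: "e > 0" for e
    proof -
      have "{Inl x, Inl x'} \<subseteq> I" "e / 3 > 0" using x e by (auto simp: I_def)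
      then obtain n where n: "n \<ge> nat \<lceil>1 / (e / 3)\<rceil>"
        "\<forall>i\<in>{Inl x, Inl x'}. mdist (V i) (p i) (F n i) < e / 3"
        using cluster[rule_format, of "{Inl x, Inl x'}" "e / 3" "nat \<lceil>1 / (e / 3)\<rceil>"] by blast
      then have close: "mdist Y (f' x) (f n x) < e / 3" "mdist Y (f' x') (f n x') < e / 3"
        by (auto simp: V_def F_def f'_def)
      have "\<bar>mdist X x x' - mdist Y (f n x) (f n x')\<bar> \<le> e / 3"
        using correspondenceD(5)[OF R f[OF x(1)] f[OF x(2)]] small[OF \<open>e / 3 > 0\<close> n(1)]
        by (rule order_trans)
      then show ?thesis
        using close f'Y[OF x(1)] f'Y[OF x(2)] fY[OF x(1), of n] fY[OF x(2), of n]
          mdist_triangle[of "f' x" Y "f n x" "f' x'"] mdist_triangle[of "f n x" Y "f n x'" "f' x'"]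
          mdist_triangle[of "f n x" Y "f' x" "f n x'"] mdist_triangle[of "f' x" Y "f' x'" "f n x'"]
          mdist_commute[of Y "f n x" "f' x"] mdist_commute[of Y "f n x'" "f' x'"] by linarith
    qed
    then have "\<bar>mdist Y (f' x) (f' x') - mdist X x x'\<bar> \<le> 0"
      by (rule dense_ge)
    then show ?thesis by simp
  qed
  have inv: "f' (g' y) = y" if y: "y \<in> mspace Y" for y
  proof -
    have "mdist Y (f' (g' y)) y \<le> e" if e: "e > 0" for e
    proof -
      note x = g'X[OF y]
      have "{Inl (g' y), Inr y} \<subseteq> I" "e / 3 > 0" using x y e by (auto simp: I_def)
      then obtain n where n: "n \<ge> nat \<lceil>1 / (e / 3)\<rceil>"
        "\<forall>i\<in>{Inl (g' y), Inr y}. mdist (V i) (p i) (F n i) < e / 3"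
        using cluster[rule_format, of "{Inl (g' y), Inr y}" "e / 3" "nat \<lceil>1 / (e / 3)\<rceil>"] by blast
      then have close: "mdist Y (f' (g' y)) (f n (g' y)) < e / 3" "mdist X (g' y) (g n y) < e / 3"
        by (auto simp: V_def F_def f'_def g'_def)
      \<comment> \<open>Both \<open>(g' y, f n (g' y))\<close> and \<open>(g n y, y)\<close> lie in
        \<open>R n\<close>, so closeness of \<open>g' y\<close> to \<open>g n y\<close> carries over
        to \<open>f n (g' y)\<close> and \<open>y\<close>.\<close>
      have "\<bar>mdist X (g' y) (g n y) - mdist Y (f n (g' y)) y\<bar> \<le> e / 3"
        using correspondenceD(5)[OF R f[OF x] g[OF y]] small[OF \<open>e / 3 > 0\<close> n(1)]
        by (rule order_trans)
      then show ?thesis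
        using close mdist_triangle[of "f' (g' y)" Y "f n (g' y)" y] f'Y[OF x] fY[OF x, of n] y
        by linarith
    qed
    then have "mdist Y (f' (g' y)) y \<le> 0"
      by (rule dense_ge)
    then show ?thesis
      using mdist_zero[OF f'Y[OF g'X[OF y]] y] mdist_nonneg[of Y "f' (g' y)" y] by linarith
  qed
  have "f' ` mspace X = mspace Y"
    using inv f'Y g'X by force
  then show ?thesis
    using f'Y dist unfolding isometric_def isometric_injection_def by blast
qed

text \<open>Distance 0 yields correspondences of every positive distortion. Conversely the diagonal
  has distortion 0, used with arbitrary \<open>r > 0\<close> because gluing needs a positive
  constant.\<close>

lemma gh_dist_eq_0_iff:
  assumes X: "compact_metric X" and Y: "compact_metric Y"
  shows "gh_dist X Y = 0 \<longleftrightarrow> isometric X Y"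
proof
  assume 0: "gh_dist X Y = 0"
  show "isometric X Y"
  proof (rule isometric_if_correspondences[OF X Y])
    fix r :: real assume "r > 0"
    then have "gh_dist X Y < r / 2" using 0 by simp
    then show "\<exists>R. correspondence X Y r R"
      by (rule gh_dist_lessD[OF X Y]) auto
  qed
next
  assume "isometric X Y"
  then have "gh_dist X Y = gh_dist X X"
    using gh_dist_isometric isometric_refl isometric_sym by blast
  also have "gh_dist X X \<le> 0"
  proof (rule dense_ge)
    fix r :: real assume r: "r > 0"
    have "correspondence X X (2 * r) (Id_on (mspace X))"
      by (rule correspondenceI) (use r in auto)
    then show "gh_dist X X \<le> r"
      using r X gh_dist_le_correspondence unfolding compact_metric_def by blast
  qed
  finally show "gh_dist X Y = 0"
    using gh_dist_nonneg[OF X Y] by linarith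
qed

section \<open>The metric on isometry classes\<close>

lemma compact_metric_rep: "compact_metric (rep_gh_space X)"
  using Quotient_rep_reflp[OF Quotient_gh_space, of X] by (simp add: isometric_compact_def)

lemma isometric_rep_iff: "isometric (rep_gh_space X) (rep_gh_space Y) \<longleftrightarrow> X = Y"
  using Quotient_rel_rep[OF Quotient_gh_space, of X Y] compact_metric_rep
  by (simp add: isometric_compact_def)

lemma isometric_rep_abs:
  "compact_metric X \<Longrightarrow> isometric (rep_gh_space (abs_gh_space X)) X"
  using Quotient_rep_abs[OF Quotient_gh_space, of X]
  by (simp add: isometric_compact_def isometric_refl)

interpretation GH: Metric_space UNIV GH_dist
proof
  fix X Y Z
  show "0 \<le> GH_dist X Y"
    by (simp add: GH_dist.rep_eq gh_dist_nonneg compact_metric_rep)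
  show "GH_dist X Y = GH_dist Y X"
    by (simp add: GH_dist.rep_eq gh_dist_commute_le compact_metric_rep order_antisym)
  show "GH_dist X Y = 0 \<longleftrightarrow> X = Y"
    by (simp add: GH_dist.rep_eq gh_dist_eq_0_iff compact_metric_rep isometric_rep_iff)
  show "GH_dist X Z \<le> GH_dist X Y + GH_dist Y Z"
    by (simp add: GH_dist.rep_eq gh_dist_triangle compact_metric_rep)
qed

section \<open>Separated collinear triples\<close>

text \<open>The threshold \<open>s\<close> makes distinctness quantitative, so that it survives
  small perturbations.\<close>

definition separated_collinear :: "'a metric \<Rightarrow> real \<Rightarrow> bool" where
  "separated_collinear X s \<longleftrightarrow>
     (\<exists>x\<in>mspace X. \<exists>y\<in>mspace X. \<exists>z\<in>mspace X.
        s \<le> mdist X x y \<and> s \<le> mdist X y z \<and> s \<le> mdist X x z \<and> collinear_in X x y z)"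

lemma collinear_free_iff:
  "collinear_free X \<longleftrightarrow> (\<forall>n. \<not> separated_collinear X (1 / Suc n))"
proof
  assume X: "collinear_free X"
  show "\<forall>n. \<not> separated_collinear X (1 / Suc n)"
  proof (intro allI notI)
    fix n assume "separated_collinear X (1 / Suc n)"
    then obtain x y z where xyz: "x \<in> mspace X" "y \<in> mspace X" "z \<in> mspace X"
      "1 / Suc n \<le> mdist X x y" "1 / Suc n \<le> mdist X y z" "1 / Suc n \<le> mdist X x z"
      "collinear_in X x y z"
      unfolding separated_collinear_def by blast
    have "(0::real) < 1 / Suc n" by simp
    then have "mdist X x y \<noteq> 0" "mdist X y z \<noteq> 0" "mdist X x z \<noteq> 0"
      using xyz(4-6) by linarith+
    then have "x \<noteq> y" "y \<noteq> z" "x \<noteq> z"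
      using xyz(1-3) by auto
    then show False
      using X xyz unfolding collinear_free_def by blast
  qed
next
  assume X: "\<forall>n. \<not> separated_collinear X (1 / Suc n)"
  show "collinear_free X"
    unfolding collinear_free_def
  proof (intro ballI impI notI)
    fix x y z
    assume xyz: "x \<in> mspace X" "y \<in> mspace X" "z \<in> mspace X"
      "x \<noteq> y \<and> y \<noteq> z \<and> x \<noteq> z" "collinear_in X x y z"
    have "mdist X x y \<noteq> 0" "mdist X y z \<noteq> 0" "mdist X x z \<noteq> 0"
      using xyz by simp_all
    then have "0 < min (mdist X x y) (min (mdist X y z) (mdist X x z))"
      by (simp add: order_less_le)
    then obtain n where "1 / Suc n < min (mdist X x y) (min (mdist X y z) (mdist X x z))"
      using nat_approx_posE by blast
    then have "1 / Suc n \<le> mdist X x y" "1 / Suc n \<le> mdist X y z" "1 / Suc n \<le> mdist X x z"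
      by linarith+
    then have "separated_collinear X (1 / Suc n)"
      using xyz unfolding separated_collinear_def by blast
    then show False using X by blast
  qed
qed

text \<open>Distinctness is essential: for \<open>x = y\<close> or \<open>y = z\<close> the
  inequality would force \<open>e \<le> 0\<close>.\<close>

definition slack_ge :: "'a metric \<Rightarrow> real \<Rightarrow> bool" where
  "slack_ge X e \<longleftrightarrow>
     (\<forall>x\<in>mspace X. \<forall>y\<in>mspace X. \<forall>z\<in>mspace X. x \<noteq> y \<and> y \<noteq> z \<and> x \<noteq> z \<longrightarrow>
        mdist X x z + e \<le> mdist X x y + mdist X y z)"

text \<open>Lift a triple of \<open>Y\<close> to \<open>X\<close>. Since \<open>r < s\<close> the
  lifted points stay distinct; each of the three distances is off by at most \<open>r\<close>, so an
  equality in \<open>Y\<close> would leave a slack of at most \<open>3 * r < e\<close> in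
  \<open>X\<close>.\<close>

lemma not_separated_collinear_if_correspondence:
  assumes R: "correspondence X Y r R" and X: "slack_ge X e" and r: "3 * r < e" "r < s"
  shows "\<not> separated_collinear Y s"
proof
  assume "separated_collinear Y s"
  then obtain x y z where xyz: "x \<in> mspace Y" "y \<in> mspace Y" "z \<in> mspace Y"
      "s \<le> mdist Y x y" "s \<le> mdist Y y z" "s \<le> mdist Y x z" "collinear_in Y x y z"
    unfolding separated_collinear_def by blast
  obtain a b c where abc: "(a, x) \<in> R" "(b, y) \<in> R" "(c, z) \<in> R"
    using xyz(1-3) correspondenceD(4)[OF R] by metis
  note d = correspondenceD(5)[OF R abc(1) abc(2)] correspondenceD(5)[OF R abc(2) abc(3)]
    correspondenceD(5)[OF R abc(1) abc(3)]
  note mem = abc[THEN correspondenceD(1)[OF R]]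
  have "mdist X a b \<noteq> 0" "mdist X b c \<noteq> 0" "mdist X a c \<noteq> 0"
    using d xyz(4-6) r(2) by linarith+
  then have ne: "a \<noteq> b" "b \<noteq> c" "a \<noteq> c"
    using mem by auto
  have "mdist X a c + e \<le> mdist X a b + mdist X b c"
    "mdist X a b + e \<le> mdist X a c + mdist X c b"
    "mdist X b c + e \<le> mdist X b a + mdist X a c"
    using X mem ne by (simp_all add: slack_ge_def)
  then show False
    using d r(1) xyz(7) mdist_commute[of X c b] mdist_commute[of X b a]
    unfolding collinear_in_def by linarith
qed

text \<open>The added \<open>e\<close> counts once on the left of a triangle inequality and twice on
  the right, which leaves slack \<open>e\<close>. The distortion \<open>3 * e\<close> is
  \<open>2 * e\<close> for moving both points to the net plus \<open>e\<close> for the changed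
  metric.\<close>

lemma ex_slack_approximation:
  fixes X :: "'a metric"
  assumes X: "compact_metric X" and e: "e > 0"
  obtains Y :: "'a metric" and R where "compact_metric Y" "slack_ge Y e" "correspondence X Y (3 * e) R"
proof -
  interpret X: Metric_space "mspace X" "mdist X" by simp
  have "X.mtotally_bounded (mspace X)"
    using X by (simp add: compact_metric_def mtopology_of_def X.compact_space_eq_mcomplete_mtotally_bounded)
  then have "\<exists>K. finite K \<and> K \<subseteq> mspace X \<and> mspace X \<subseteq> (\<Union>x\<in>K. X.mball x e)"
    using e unfolding X.mtotally_bounded_def by simp
  then obtain K where K: "finite K" "K \<subseteq> mspace X" "mspace X \<subseteq> (\<Union>x\<in>K. X.mball x e)"
    by blast
  have "K \<noteq> {}"
    using K(3) X by (auto simp: compact_metric_def)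
  define d where "d x y = (if x = y then 0 else mdist X x y + e)" for x y
  interpret Y: Metric_space K d
  proof
    fix x y
    show "0 \<le> d x y" "d x y = d y x"
      using e by (auto simp: d_def mdist_commute intro: add_nonneg_nonneg)
    show "d x y = 0 \<longleftrightarrow> x = y"
      using e add_nonneg_pos[OF mdist_nonneg[of X x y] e] by (auto simp: d_def)
  next
    fix x y z assume "x \<in> K" "y \<in> K" "z \<in> K"
    then have "mdist X x z \<le> mdist X x y + mdist X y z"
      using K(2) by (intro mdist_triangle) auto
    moreover have "0 \<le> mdist X x y" "0 \<le> mdist X y z"
      by simp_all
    ultimately show "d x z \<le> d x y + d y z"
      using e by (smt (verit, best) d_def)
  qed
  have "compact_metric Y.Self"
    using K(1) \<open>K \<noteq> {}\<close>
    by (simp add: compact_metric_def mtopology_of_def compact_space_def finite_imp_compactin)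
  moreover have "slack_ge Y.Self e"
    unfolding slack_ge_def
  proof (intro ballI impI)
    fix x y z assume *: "x \<in> mspace Y.Self" "y \<in> mspace Y.Self" "z \<in> mspace Y.Self"
      "x \<noteq> y \<and> y \<noteq> z \<and> x \<noteq> z"
    then have "mdist X x z \<le> mdist X x y + mdist X y z"
      using K(2) by (intro mdist_triangle) auto
    then show "mdist Y.Self x z + e \<le> mdist Y.Self x y + mdist Y.Self y z"
      using * by (simp add: d_def)
  qed
  moreover have "correspondence X Y.Self (3 * e) {(x, k). x \<in> mspace X \<and> k \<in> K \<and> mdist X x k < e}"
  proof (rule correspondenceI)
    fix x assume "x \<in> mspace X"
    then obtain k where "k \<in> K" "mdist X k x < e"
      using K(3) by auto
    then show "\<exists>k. (x, k) \<in> {(x, k). x \<in> mspace X \<and> k \<in> K \<and> mdist X x k < e}"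
      using \<open>x \<in> mspace X\<close> by (auto simp: mdist_commute)
  next
    fix k assume "k \<in> mspace Y.Self"
    then show "\<exists>x. (x, k) \<in> {(x, k). x \<in> mspace X \<and> k \<in> K \<and> mdist X x k < e}"
      using K(2) e by (intro exI[of _ k]) auto
  next
    fix a b a' b'
    assume "(a, b) \<in> {(x, k). x \<in> mspace X \<and> k \<in> K \<and> mdist X x k < e}"
      "(a', b') \<in> {(x, k). x \<in> mspace X \<and> k \<in> K \<and> mdist X x k < e}"
    then have *: "a \<in> mspace X" "b \<in> mspace X" "a' \<in> mspace X" "b' \<in> mspace X"
      "mdist X a b < e" "mdist X a' b' < e" using K(2) by auto
    have "mdist X b b' \<le> d b b'" "d b b' \<le> mdist X b b' + e"
      using e *(2) by (auto simp: d_def)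
    then have "\<bar>mdist X a a' - d b b'\<bar> \<le> 3 * e"
      using * e mdist_triangle[of a X b a'] mdist_triangle[of b X b' a']
        mdist_triangle[of b X a b'] mdist_triangle[of a X a' b']
        mdist_commute[of X b a] mdist_commute[of X b' a'] by linarith
    then show "\<bar>mdist X a a' - mdist Y.Self b b'\<bar> \<le> 3 * e"
      by simp
  qed auto
  ultimately show ?thesis by (rule that)
qed

lemma rare_separated_collinear:
  assumes s: "s > 0"
  shows "rare_in GH_topology {X. separated_collinear (rep_gh_space X) s}" (is "rare_in _ ?B")
proof -
  let ?C = "GH_topology closure_of ?B"
  have "GH_topology interior_of ?C = {}"
  proof (rule ccontr)
    assume "GH_topology interior_of ?C \<noteq> {}"
    then obtain X where "X \<in> GH_topology interior_of ?C" by blast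
    then obtain \<rho> where \<rho>: "\<rho> > 0" "GH.mball X \<rho> \<subseteq> GH_topology interior_of ?C"
      using openin_interior_of[of GH_topology ?C] unfolding GH.openin_mtopology by blast
    \<comment> \<open>Distortion \<open>3 * e\<close> means distance at most
      \<open>3 * e / 2 = \<rho> / 2\<close>, inside the ball.\<close>
    define e where "e = \<rho> / 3"
    have e: "e > 0" using \<rho>(1) by (simp add: e_def)
    obtain Y :: "real metric" and R where Y: "compact_metric Y" "slack_ge Y e"
      and R: "correspondence (rep_gh_space X) Y (3 * e) R"
      using ex_slack_approximation[OF compact_metric_rep e] by blast
    define Y' where "Y' = abs_gh_space Y"
    have iso: "isometric (rep_gh_space Y') Y"
      unfolding Y'_def by (rule isometric_rep_abs[OF Y(1)])
    have "gh_dist (rep_gh_space X) Y \<le> 3 * e / 2"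
      by (rule gh_dist_le_correspondence)
        (use R e compact_metric_rep in \<open>auto simp: compact_metric_def\<close>)
    then have "GH_dist X Y' < \<rho>"
      using gh_dist_isometric[OF isometric_refl iso] \<rho>(1) by (simp add: GH_dist.rep_eq e_def)
    then have "Y' \<in> ?C"
      using \<rho>(2) interior_of_subset[of GH_topology ?C] by auto
    \<comment> \<open>Distance below \<open>t\<close> gives distortion \<open>2 * t\<close>, and
      \<open>6 * t < e\<close> and \<open>2 * t < s\<close> are needed to exclude separated
      collinear triples.\<close>
    define t where "t = min (e / 7) (s / 3)"
    have t: "t > 0" "3 * (2 * t) < e" "2 * t < s"
      using e s by (auto simp: t_def min_def)
    obtain Z where Z: "Z \<in> ?B" "GH_dist Y' Z < t"
      using \<open>Y' \<in> ?C\<close> t(1) unfolding GH.metric_closure_of by auto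
    have "gh_dist Y (rep_gh_space Z) < t"
      using Z(2) gh_dist_isometric[OF iso isometric_refl] by (simp add: GH_dist.rep_eq)
    then obtain S where "correspondence Y (rep_gh_space Z) (2 * t) S"
      using gh_dist_lessD[OF Y(1) compact_metric_rep] by blast
    then have "\<not> separated_collinear (rep_gh_space Z) s"
      using not_separated_collinear_if_correspondence Y(2) t(2,3) by blast
    then show False using Z(1) by simp
  qed
  then show ?thesis by (simp add: rare_in_def)
qed

theorem theorem3:
  shows "residual_in GH_topology {X. no_three_collinear X}"
proof -
  let ?B = "\<lambda>n. {X. separated_collinear (rep_gh_space X) (1 / Suc n)}"
  have "topspace GH_topology - {X. no_three_collinear X} = \<Union> (range ?B)"
    by (auto simp: no_three_collinear.rep_eq collinear_free_iff)
  moreover have "\<forall>S\<in>range ?B. rare_in GH_topology S"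
    using rare_separated_collinear by auto
  ultimately have "meager_in GH_topology (topspace GH_topology - {X. no_three_collinear X})"
    unfolding meager_in_def by (intro exI[of _ "range ?B"]) simp
  then show ?thesis by (simp add: residual_in_def)
qed

end
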